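(* There is an absolute constant $C>0$ such that for any $L>0$, any matrix $A\in[-L,L]^{n\times m}$ and any $\gamma\in(0,1)$, writing $N=\sqrt{nm}$, there exists a decomposition $A=A^{\mathrm{str}}+A^{\mathrm{psd}}$ with $A^{\mathrm{str}},A^{\mathrm{psd}}\in\mathbb{R}^{n\times m}$ such that: (1) $A^{\mathrm{str}}$ is a block matrix with at most $C\left(\frac{1}{\gamma^{10}}\right)^{3/\gamma^2}$ blocks, such that the entries in each block are equal; (2) $\|A^{\mathrm{psd}}\|_2\le 7\gamma NL$; (3) $\|A^{\mathrm{str}}\|_{\max}\le \frac{2}{\gamma^{11}}L$.
   Context: A matrix $B\in\mathbb{R}^{n\times m}$ is a block matrix with at most $K$ blocks whose entries in each block are equal if there are partitions $\{R_1,\dots,R_p\}$ of $\{1,\dots,n\}$ and $\{C_1,\dots,C_q\}$ of $\{1,\dots,m\}$ (parts need not be contiguous) with $pq\le K$ such that $B$ is constant on each $R_i\times C_j$. $\|B\|_2$ denotes the spectral norm (largest singular value) and $\|B\|_{\max}=\max_{i,j}|B_{ij}|$. *)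

theory Defs
  imports
    Complex_Main
    "HOL-Library.Disjoint_Sets"
    "Jordan_Normal_Form.Char_Poly"
begin

text \<open>Matrices are the dimension-carrying matrices \<^typ>\<open>real mat\<close>, with rows and columns indexed
  from 0: the dimensions are natural numbers, so that an absolute constant can be chosen
  before them.\<close>

definition block_matrix :: "real mat \<Rightarrow> real \<Rightarrow> bool" where
  "block_matrix B K \<longleftrightarrow>
     (\<exists>R C. partition_on {..<dim_row B} R \<and> partition_on {..<dim_col B} C \<and>
        real (card R * card C) \<le> K \<and>
        (\<forall>r\<in>R. \<forall>c\<in>C. \<exists>x. \<forall>i\<in>r. \<forall>j\<in>c. B $$ (i, j) = x))"

text \<open>The Gram matrix is symmetric positive semidefinite, so its real eigenvalues are all its
  eigenvalues and are nonnegative. For a wide matrix this set may contain an additional 0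
  compared to the convention with only as many singular values as the smaller dimension; the
  largest element is the same.\<close>

definition singular_values :: "real mat \<Rightarrow> real set" where
  "singular_values B = sqrt ` {e. eigenvalue (transpose_mat B * B) e}"

text \<open>The next two norms are meaningful only for matrices with at least one row and one column,
  as \<^const>\<open>Max\<close> is unspecified on the empty set.\<close>

definition spectral_norm :: "real mat \<Rightarrow> real" where
  "spectral_norm B = Max (singular_values B)"

definition max_norm :: "real mat \<Rightarrow> real" where
  "max_norm B = Max {\<bar>B $$ (i, j)\<bar> | i j. i < dim_row B \<and> j < dim_col B}"

end

theory Submission
  imports Defs "HOL-Analysis.L2_Norm" "Jordan_Normal_Form.Spectral_Radius"
begin

text \<open>
  For \<open>\<gamma> \<ge> 1/7\<close> the structured part can be 0, since the spectral norm of \<open>A\<close> is at most \<open>N L\<close>.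
  Otherwise write \<open>A = \<Sum>\<^sub>j w\<^sub>j v\<^sub>j\<^sup>T\<close>, where the \<open>v\<^sub>j\<close> form an orthonormal eigenbasis of \<open>A\<^sup>T A\<close> and the
  \<open>w\<^sub>j = A v\<^sub>j\<close> are orthogonal, and keep the terms with \<open>|w\<^sub>j| > \<gamma> N L\<close>. Comparing Frobenius norms, there
  are at most \<open>1/\<gamma>\<^sup>2\<close> of them. The entries of \<open>w\<^sub>j\<close> are at most \<open>\<surd>m L\<close>, and those of
  \<open>v\<^sub>j = A\<^sup>T w\<^sub>j / |w\<^sub>j|\<^sup>2\<close> at most \<open>1/(\<gamma> \<surd>m)\<close>. Rounding both to a grid of relative mesh \<open>\<gamma>\<^sup>3\<close> costs
  \<open>3 \<gamma> N L\<close> in operator norm, and the rounded sum is constant on the products of the level sets of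
  the rounded vectors.
\<close>

section \<open>The spectral theorem for real symmetric matrices\<close>

text \<open>Over the complex numbers the spectrum is nonempty. Symmetry makes the quadratic form at
  an eigenvector real, hence the eigenvalue too, and then the real and imaginary parts of the
  eigenvector each satisfy the eigenvalue equation. One of them is nonzero and can be
  normalized.\<close>

lemma symmetric_real_eigenpair:
  fixes S :: "nat \<Rightarrow> nat \<Rightarrow> real"
  assumes m: "m > 0" and sym: "\<forall>l<m. \<forall>p<m. S l p = S p l"
  obtains e v where "(\<Sum>l<m. (v l)\<^sup>2) = 1" "\<And>l. l < m \<Longrightarrow> (\<Sum>p<m. S l p * v p) = e * v l"
proof -
  define M :: "complex mat" where "M = mat m m (\<lambda>(l, p). of_real (S l p))"
  have M: "M \<in> carrier_mat m m" unfolding M_def by simp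
  from spectrum_non_empty[OF M] m obtain a where "eigenvalue M a"
    unfolding spectrum_def by auto
  then obtain y where y: "y \<in> carrier_vec m" "y \<noteq> 0\<^sub>v m" "M *\<^sub>v y = a \<cdot>\<^sub>v y"
    unfolding eigenvalue_def eigenvector_def using M by auto
  define x where "x l = y $ l" for l
  have ev: "(\<Sum>p<m. of_real (S l p) * x p) = a * x l" if "l < m" for l
  proof -
    have "(M *\<^sub>v y) $ l = (\<Sum>p<m. of_real (S l p) * x p)"
      using that y(1) M by (simp add: M_def scalar_prod_def x_def lessThan_atLeast0)
    then show ?thesis using y that by (simp add: x_def)
  qed
  from y(1,2) obtain l0 where l0: "l0 < m" "x l0 \<noteq> 0"
    unfolding x_def by (metis carrier_vecD eq_vecI index_zero_vec(1) index_zero_vec(2))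
  define s where "s = (\<Sum>l<m. (cmod (x l))\<^sup>2)"
  have s: "s > 0" unfolding s_def by (rule sum_pos2[of _ l0]) (use l0 in auto)
  \<comment> \<open>The Hermitian form of \<open>S\<close> at \<open>x\<close>. It equals
    \<open>a\<close> times the squared norm of \<open>x\<close>, and by symmetry of \<open>S\<close>
    it equals its own conjugate, which forces \<open>a\<close> to be real.\<close>
  define q where "q = (\<Sum>l<m. \<Sum>p<m. cnj (x l) * of_real (S l p) * x p)"
  have "q = (\<Sum>l<m. cnj (x l) * (a * x l))"
    unfolding q_def by (rule sum.cong) (auto simp: ev[symmetric] sum_distrib_left mult.assoc)
  also have "\<dots> = a * of_real s"
    unfolding s_def of_real_sum sum_distrib_left complex_norm_square
    by (rule sum.cong) (auto simp: mult_ac)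
  finally have qa: "q = a * of_real s" .
  have "cnj q = (\<Sum>l<m. \<Sum>p<m. cnj (x p) * of_real (S p l) * x l)"
    unfolding q_def cnj_sum by (intro sum.cong) (auto simp: sym mult_ac)
  also have "\<dots> = q" unfolding q_def by (rule sum.swap)
  finally have "cnj a * of_real s = a * of_real s" unfolding qa by simp
  then have "cnj a = a" using s by simp
  then have a: "a = of_real (Re a)" by (metis Reals_cnj_iff of_real_Re)
  have re: "(\<Sum>p<m. S l p * Re (x p)) = Re a * Re (x l)" if "l < m" for l
    using arg_cong[OF ev[OF that], of Re] arg_cong[OF a, of Im] by simp
  have im: "(\<Sum>p<m. S l p * Im (x p)) = Re a * Im (x l)" if "l < m" for l
    using arg_cong[OF ev[OF that], of Im] arg_cong[OF a, of Im] by simp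
  \<comment> \<open>Since \<open>x l0\<close> is nonzero, its real or its imaginary part is, so the
    corresponding part of \<open>x\<close> is a nonzero vector.\<close>
  obtain z where z: "z l0 \<noteq> (0::real)" "\<And>l. l < m \<Longrightarrow> (\<Sum>p<m. S l p * z p) = Re a * z l"
  proof (cases "Re (x l0) = 0")
    case True
    then have "Im (x l0) \<noteq> 0" using l0 by (simp add: complex_eq_iff)
    then show ?thesis by (rule that) (rule im)
  next
    case False
    then show ?thesis by (rule that) (rule re)
  qed
  define t where "t = (\<Sum>l<m. (z l)\<^sup>2)"
  have t: "t > 0" unfolding t_def by (rule sum_pos2[of _ l0]) (use l0 z in auto)
  show thesis
  proof
    show "(\<Sum>l<m. (z l / sqrt t)\<^sup>2) = 1"
      using t by (simp add: power_divide sum_divide_distrib[symmetric] t_def[symmetric])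
    show "(\<Sum>p<m. S l p * (z p / sqrt t)) = Re a * (z l / sqrt t)" if "l < m" for l
      using z(2)[OF that] by (simp add: sum_divide_distrib[symmetric])
  qed
qed

lemma sum_delta_mult:
  fixes f :: "nat \<Rightarrow> real"
  assumes "k < m"
  shows "(\<Sum>p<m. of_bool (k = p) * f p) = f k" "(\<Sum>p<m. of_bool (p = k) * f p) = f k"
  "(\<Sum>p<m. f p * of_bool (k = p)) = f k" "(\<Sum>p<m. f p * of_bool (p = k)) = f k"
  using assms by (auto simp: of_bool_def if_distrib if_distribR sum.delta sum.delta' cong: if_cong)

text \<open>For \<open>v = e\<^sub>k\<close> the quotient in the definition of \<open>H\<close> is 0, which makes \<open>H\<close> the identity.\<close>

lemma householder:
  fixes v :: "nat \<Rightarrow> real"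
  assumes k: "k < m" and v: "(\<Sum>l<m. (v l)\<^sup>2) = 1"
  obtains H :: "nat \<Rightarrow> nat \<Rightarrow> real" where
    "\<And>l p. l < m \<Longrightarrow> p < m \<Longrightarrow> H l p = H p l"
    "\<And>l p. l < m \<Longrightarrow> p < m \<Longrightarrow> (\<Sum>r<m. H l r * H r p) = of_bool (l = p)"
    "\<And>l. l < m \<Longrightarrow> H l k = v l"
proof -
  define w where "w l = v l - of_bool (l = k)" for l
  define s where "s = (\<Sum>l<m. (w l)\<^sup>2)"
  define H where "H l p = of_bool (l = p) - 2 * w l * w p / s" for l p
  \<comment> \<open>Both \<open>v\<close> and the unit vector at \<open>k\<close> have norm 1, so
    the squared norm of their difference depends only on \<open>v k\<close>.\<close>
  have ss: "s = 2 - 2 * v k"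
  proof -
    have "s = (\<Sum>l<m. (v l)\<^sup>2 - 2 * (v l * of_bool (l = k)) + of_bool (l = k) * 1)"
      unfolding s_def w_def by (rule sum.cong) (auto simp: power2_eq_square algebra_simps)
    also have "\<dots> = 2 - 2 * v k"
      unfolding sum.distrib sum_subtractf sum_distrib_left[symmetric] sum_delta_mult[OF k] v by simp
    finally show ?thesis .
  qed
  have w0: "w l = 0" if "s = 0" "l < m" for l
    using that unfolding s_def by (subst (asm) sum_nonneg_eq_0_iff) auto
  show thesis
  proof
    show "H l p = H p l" for l p unfolding H_def by (auto simp: mult_ac)
    show "(\<Sum>r<m. H l r * H r p) = of_bool (l = p)" if "l < m" "p < m" for l p
    proof -
      have "(\<Sum>r<m. H l r * H r p) = (\<Sum>r<m. of_bool (l = r) * of_bool (r = p)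
          - of_bool (l = r) * (2 * w r * w p / s) - 2 * w l * w r / s * of_bool (r = p)
          + (4 * w l * w p / s / s) * (w r)\<^sup>2)"
        unfolding H_def by (rule sum.cong) (auto simp: power2_eq_square algebra_simps)
      also have "\<dots> = of_bool (l = p) - 2 * w l * w p / s - 2 * w l * w p / s + 4 * w l * w p / s / s * s"
        unfolding sum.distrib sum_subtractf sum_distrib_left[symmetric] sum_delta_mult[OF that(1)]
          sum_delta_mult[OF that(2)] s_def[symmetric] by simp
      \<comment> \<open>The two cross terms cancel against the quadratic one. For
        \<open>s = 0\<close> all three vanish, as division by 0 gives 0.\<close>
      also have "\<dots> = of_bool (l = p)" by simp
      finally show ?thesis .
    qed
    show "H l k = v l" if "l < m" for l
    proof (cases "s = 0")
      case True
      then show ?thesis using w0[OF True that] unfolding H_def w_def by auto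
    next
      case False
      \<comment> \<open>This is why the reflection along \<open>w\<close> takes the unit vector at
        \<open>k\<close> to \<open>v\<close>: its column \<open>k\<close> subtracts
        \<open>2 * w k / s = -1\<close> times \<open>w\<close>.\<close>
      have "2 * w k = - s" unfolding ss w_def by simp
      then have "2 * w l * w k / s = - w l" using False
        by (metis (no_types, opaque_lifting) minus_divide_left mult.assoc mult.commute mult_minus_left nonzero_mult_div_cancel_left)
      then show ?thesis unfolding H_def by (simp add: w_def)
    qed
  qed
qed

text \<open>Deflation by induction on the dimension: a Householder reflection \<open>H\<close> moves
  the last unit vector to a unit eigenvector, so \<open>H S H\<close> splits into a corner entry and
  a symmetric block of size \<open>m\<close>. An eigenbasis of the block, extended by the last unit
  vector, is carried back by \<open>H\<close>. The eigenvectors are the rows of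
  \<open>V\<close>.\<close>

lemma spectral_theorem_aux:
  fixes S :: "nat \<Rightarrow> nat \<Rightarrow> real"
  assumes "\<forall>l<m. \<forall>p<m. S l p = S p l"
  shows "\<exists>V e. (\<forall>i<m. \<forall>j<m. (\<Sum>l<m. V i l * V j l) = of_bool (i = j)) \<and>
           (\<forall>j<m. \<forall>l<m. (\<Sum>p<m. S l p * V j p) = e j * V j l)"
  using assms
proof (induction m arbitrary: S)
  case 0
  then show ?case by simp
next
  case (Suc m)
  \<comment> \<open>Sums over \<open>Suc m\<close> are treated as a whole; the last summand is split
    off only where index \<open>m\<close> plays a special role.\<close>
  note sym = Suc.prems and [simp del] = sum.lessThan_Suc
  obtain c v where v: "(\<Sum>l<Suc m. (v l)\<^sup>2) = 1"
    and ev: "\<And>l. l < Suc m \<Longrightarrow> (\<Sum>p<Suc m. S l p * v p) = c * v l"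
    by (rule symmetric_real_eigenpair[of "Suc m" S, OF zero_less_Suc sym]) (rule that)
  obtain H where Hs: "\<And>l p. l < Suc m \<Longrightarrow> p < Suc m \<Longrightarrow> H l p = H p l"
    and HH: "\<And>l p. l < Suc m \<Longrightarrow> p < Suc m \<Longrightarrow> (\<Sum>r<Suc m. H l r * H r p) = of_bool (l = p)"
    and Hv: "\<And>l. l < Suc m \<Longrightarrow> H l m = v l"
    by (rule householder[OF lessI v]) (rule that)
  \<comment> \<open>\<open>h\<close> and \<open>s\<close> are the actions of \<open>H\<close> and
    \<open>S\<close> on vectors, and \<open>T\<close> is the matrix \<open>H S H\<close>.\<close>
  define h where "h f l = (\<Sum>p<Suc m. H l p * f p)" for f l
  define s where "s f l = (\<Sum>p<Suc m. S l p * f p)" for f l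
  define T where "T l p = h (s (\<lambda>r. H r p)) l" for l p
  have hh: "h (h f) l = f l" if "l < Suc m" for f l
  proof -
    have "h (h f) l = (\<Sum>p<Suc m. \<Sum>r<Suc m. H l p * H p r * f r)"
      unfolding h_def sum_distrib_left by (simp only: mult.assoc)
    also have "\<dots> = (\<Sum>r<Suc m. (\<Sum>p<Suc m. H l p * H p r) * f r)"
      unfolding sum_distrib_right by (rule sum.swap)
    also have "\<dots> = (\<Sum>r<Suc m. of_bool (l = r) * f r)"
      by (rule sum.cong) (use HH that in auto)
    also have "\<dots> = f l" by (rule sum_delta_mult[OF that])
    finally show ?thesis .
  qed
  have hcong: "h f l = h g l" if "\<And>p. p < Suc m \<Longrightarrow> f p = g p" for f g l
    unfolding h_def by (rule sum.cong) (use that in auto)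
  have scong: "s f l = s g l" if "\<And>p. p < Suc m \<Longrightarrow> f p = g p" for f g l
    unfolding s_def by (rule sum.cong) (use that in auto)
  have hself: "(\<Sum>l<Suc m. h f l * g l) = (\<Sum>l<Suc m. f l * h g l)" for f g
  proof -
    have "(\<Sum>l<Suc m. h f l * g l) = (\<Sum>l<Suc m. \<Sum>p<Suc m. H l p * f p * g l)"
      unfolding h_def sum_distrib_right ..
    also have "\<dots> = (\<Sum>p<Suc m. \<Sum>l<Suc m. H l p * f p * g l)" by (rule sum.swap)
    also have "\<dots> = (\<Sum>p<Suc m. f p * h g p)"
      unfolding h_def sum_distrib_left by (intro sum.cong) (auto simp: Hs mult_ac)
    finally show ?thesis .
  qed
  have sself: "(\<Sum>l<Suc m. s f l * g l) = (\<Sum>l<Suc m. f l * s g l)" for f g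
  proof -
    have "(\<Sum>l<Suc m. s f l * g l) = (\<Sum>l<Suc m. \<Sum>p<Suc m. S l p * f p * g l)"
      unfolding s_def sum_distrib_right ..
    also have "\<dots> = (\<Sum>p<Suc m. \<Sum>l<Suc m. S l p * f p * g l)" by (rule sum.swap)
    also have "\<dots> = (\<Sum>p<Suc m. f p * s g p)"
      unfolding s_def sum_distrib_left by (intro sum.cong) (auto simp: sym mult_ac)
    finally show ?thesis .
  qed
  \<comment> \<open>A self-adjoint involution preserves inner products; this will carry
    orthonormality from the eigenvectors of \<open>T\<close> to those of \<open>S\<close>.\<close>
  have iso: "(\<Sum>l<Suc m. h f l * h g l) = (\<Sum>l<Suc m. f l * g l)" for f g
    unfolding hself by (rule sum.cong) (auto simp: hh)
  have Tapp: "(\<Sum>p<Suc m. T l p * f p) = h (s (h f)) l" for f l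
  proof -
    have "(\<Sum>p<Suc m. T l p * f p) = (\<Sum>p<Suc m. \<Sum>r<Suc m. H l r * s (\<lambda>r. H r p) r * f p)"
      unfolding T_def h_def sum_distrib_right ..
    also have "\<dots> = (\<Sum>r<Suc m. \<Sum>p<Suc m. H l r * s (\<lambda>r. H r p) r * f p)" by (rule sum.swap)
    also have "\<dots> = (\<Sum>r<Suc m. H l r * (\<Sum>p<Suc m. s (\<lambda>r. H r p) r * f p))"
      unfolding sum_distrib_left by (simp only: mult.assoc)
    also have "\<dots> = (\<Sum>r<Suc m. H l r * s (h f) r)"
    proof -
      have "(\<Sum>p<Suc m. s (\<lambda>r. H r p) r * f p) = s (h f) r" for r
      proof -
        have "(\<Sum>p<Suc m. s (\<lambda>r. H r p) r * f p) = (\<Sum>p<Suc m. \<Sum>q<Suc m. S r q * H q p * f p)"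
          unfolding s_def sum_distrib_right ..
        also have "\<dots> = (\<Sum>q<Suc m. \<Sum>p<Suc m. S r q * H q p * f p)" by (rule sum.swap)
        also have "\<dots> = s (h f) r"
          unfolding s_def h_def sum_distrib_left by (simp only: mult.assoc)
        finally show ?thesis .
      qed
      then show ?thesis by simp
    qed
    finally show ?thesis unfolding h_def .
  qed
  have Tent: "T l p = (\<Sum>r<Suc m. H r l * s (\<lambda>r. H r p) r)" if "l < Suc m" for l p
    unfolding T_def h_def by (rule sum.cong) (use Hs that in auto)
  have Tsym: "T l p = T p l" if "l < Suc m" "p < Suc m" for l p
    unfolding Tent[OF that(1)] Tent[OF that(2)] using sself[of "\<lambda>r. H r l" "\<lambda>r. H r p"]
    by (simp only: mult.commute)
  \<comment> \<open>\<open>H\<close> takes the last unit vector to \<open>v\<close>,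
    \<open>S\<close> multiplies it by \<open>c\<close>, and \<open>H\<close> takes it back.\<close>
  have Tm: "T l m = c * of_bool (l = m)" if "l < Suc m" for l
  proof -
    have sv: "s (\<lambda>r. H r m) p = c * v p" if "p < Suc m" for p
      using scong[of "\<lambda>r. H r m" v p] ev[OF that] Hv unfolding s_def by auto
    have "T l m = h (\<lambda>p. c * H p m) l"
      unfolding T_def by (rule hcong) (use sv Hv in auto)
    also have "\<dots> = c * (\<Sum>p<Suc m. H l p * H p m)"
      unfolding h_def sum_distrib_left by (simp only: mult_ac)
    also have "\<dots> = c * of_bool (l = m)" using HH[OF that, of m] by auto
    finally show ?thesis .
  qed
  \<comment> \<open>The induction hypothesis is applied to the block of \<open>T\<close> with
    indices below \<open>m\<close>.\<close>
  obtain U e where U: "\<And>i j. i < m \<Longrightarrow> j < m \<Longrightarrow> (\<Sum>l<m. U i l * U j l) = of_bool (i = j)"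
    and Ue: "\<And>j l. j < m \<Longrightarrow> l < m \<Longrightarrow> (\<Sum>p<m. T l p * U j p) = e j * U j l"
  proof -
    have "\<forall>l<m. \<forall>p<m. T l p = T p l" using Tsym by simp
    from Suc.IH[OF this] that show thesis by metis
  qed
  \<comment> \<open>Eigenvectors of the block are padded by 0 at index \<open>m\<close>; the last
    unit vector joins them with eigenvalue \<open>c\<close>.\<close>
  define Z where "Z j l = (if j = m then of_bool (l = m) else if l = m then 0 else U j l)" for j l
  define e' where "e' j = (if j = m then c else e j)" for j
  have ZZ: "(\<Sum>l<Suc m. Z i l * Z j l) = of_bool (i = j)" if "i < Suc m" "j < Suc m" for i j
  proof -
    have *: "(\<Sum>l<m. Z i l * Z j l) = (if i = m \<or> j = m then 0 else (\<Sum>l<m. U i l * U j l))"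
      unfolding Z_def by auto
    show ?thesis unfolding sum.lessThan_Suc * using that U[of i j] by (auto simp: Z_def)
  qed
  have TZ: "(\<Sum>p<Suc m. T l p * Z j p) = e' j * Z j l" if "j < Suc m" "l < Suc m" for j l
  proof (cases "j = m")
    case True
    then show ?thesis using Tm[OF that(2)] by (simp add: Z_def e'_def sum.lessThan_Suc)
  next
    case False
    then have j: "j < m" using that by simp
    have *: "(\<Sum>p<Suc m. T l p * Z j p) = (\<Sum>p<m. T l p * U j p)"
      using False by (simp add: Z_def sum.lessThan_Suc)
    show ?thesis
    proof (cases "l = m")
      case True
      \<comment> \<open>The last row of \<open>T\<close> is its last column by symmetry, so it
        vanishes off the corner.\<close>
      have "T l p = 0" if "p < m" for p using Tsym[of l p] Tm[of p] True that by simp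
      then show ?thesis unfolding * using True False by (simp add: Z_def)
    next
      case False
      then show ?thesis unfolding * using Ue[OF j, of l] that j by (simp add: Z_def e'_def)
    qed
  qed
  show ?case
  proof (intro exI conjI allI impI)
    show "(\<Sum>l<Suc m. h (Z i) l * h (Z j) l) = of_bool (i = j)" if "i < Suc m" "j < Suc m" for i j
      unfolding iso by (rule ZZ[OF that])
    show "(\<Sum>p<Suc m. S l p * h (Z j) p) = e' j * h (Z j) l" if "j < Suc m" "l < Suc m" for j l
    proof -
      have "(\<Sum>p<Suc m. S l p * h (Z j) p) = s (h (Z j)) l" unfolding s_def ..
      \<comment> \<open>Inserting \<open>H H = 1\<close> on the left exposes
        \<open>H S H = T\<close>, for which \<open>Z j\<close> is an eigenvector.\<close>
      also have "\<dots> = h (h (s (h (Z j)))) l" by (rule hh[OF that(2), symmetric])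
      also have "\<dots> = h (\<lambda>l. e' j * Z j l) l"
        by (rule hcong) (use Tapp[of _ "Z j"] TZ[OF that(1)] in auto)
      also have "\<dots> = e' j * h (Z j) l"
        unfolding h_def sum_distrib_left by (simp only: mult_ac)
      finally show ?thesis .
    qed
  qed
qed

text \<open>The completeness relation is added to the orthonormality of the rows: for a square
  matrix a right inverse is also a left inverse, so the columns are orthonormal as well.\<close>

theorem real_spectral_theorem:
  fixes S :: "nat \<Rightarrow> nat \<Rightarrow> real"
  assumes "\<forall>l<m. \<forall>p<m. S l p = S p l"
  obtains V e where
    "\<And>i j. i < m \<Longrightarrow> j < m \<Longrightarrow> (\<Sum>l<m. V i l * V j l) = of_bool (i = j)"
    "\<And>l p. l < m \<Longrightarrow> p < m \<Longrightarrow> (\<Sum>j<m. V j l * V j p) = of_bool (l = p)"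
    "\<And>j l. j < m \<Longrightarrow> l < m \<Longrightarrow> (\<Sum>p<m. S l p * V j p) = e j * V j l"
proof -
  obtain V e where V: "\<And>i j. i < m \<Longrightarrow> j < m \<Longrightarrow> (\<Sum>l<m. V i l * V j l) = of_bool (i = j)"
    and e: "\<And>j l. j < m \<Longrightarrow> l < m \<Longrightarrow> (\<Sum>p<m. S l p * V j p) = e j * V j l"
    using spectral_theorem_aux[OF assms] by metis
  define M where "M = mat m m (\<lambda>(j, l). V j l)"
  have M: "M \<in> carrier_mat m m" "transpose_mat M \<in> carrier_mat m m" unfolding M_def by auto
  have "M * transpose_mat M = 1\<^sub>m m"
    using V by (intro eq_matI) (auto simp: M_def scalar_prod_def lessThan_atLeast0)
  then have MM: "transpose_mat M * M = 1\<^sub>m m"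
    using mat_mult_left_right_inverse[OF M] by simp
  have "(\<Sum>j<m. V j l * V j p) = of_bool (l = p)" if "l < m" "p < m" for l p
    using arg_cong[OF MM, of "\<lambda>X. X $$ (l, p)"] that
    by (simp add: M_def scalar_prod_def lessThan_atLeast0)
  from V this e show thesis by (rule that)
qed

section \<open>Euclidean norms and operator bounds\<close>

lemma abs_sum_mult_le_L2_set:
  fixes f g :: "'a \<Rightarrow> real"
  shows "\<bar>\<Sum>i\<in>A. f i * g i\<bar> \<le> L2_set f A * L2_set g A"
proof -
  have "\<bar>\<Sum>i\<in>A. f i * g i\<bar> \<le> (\<Sum>i\<in>A. \<bar>f i\<bar> * \<bar>g i\<bar>)"
    using sum_abs[of "\<lambda>i. f i * g i" A] by (simp add: abs_mult)
  also have "\<dots> \<le> L2_set f A * L2_set g A" by (rule L2_set_mult_ineq)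
  finally show ?thesis .
qed

lemma L2_set_power2: "(L2_set f A)\<^sup>2 = (\<Sum>i\<in>A. (f i)\<^sup>2)"
  unfolding L2_set_def by (simp add: sum_nonneg)

lemma L2_set_le_bound:
  assumes "\<And>i. i < n \<Longrightarrow> \<bar>f i\<bar> \<le> b" "b \<ge> 0"
  shows "L2_set f {..<n} \<le> sqrt (real n) * b"
proof -
  have "(\<Sum>i<n. (f i)\<^sup>2) \<le> (\<Sum>i<n. b\<^sup>2)"
    by (rule sum_mono) (use assms in \<open>auto simp: abs_le_square_iff[symmetric]\<close>)
  then have "L2_set f {..<n} \<le> sqrt (real n * b\<^sup>2)"
    unfolding L2_set_def by simp
  then show ?thesis using assms(2) by (simp add: real_sqrt_mult)
qed

text \<open>An upper bound \<open>c\<close> for the Euclidean operator norm, stated as an inequality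
  rather than through a supremum so that bounds for sums add up directly. Plain functions as
  matrices avoid carrier conditions for the rank-one terms.\<close>

definition op_bounded :: "nat \<Rightarrow> nat \<Rightarrow> (nat \<Rightarrow> nat \<Rightarrow> real) \<Rightarrow> real \<Rightarrow> bool" where
  "op_bounded n m B c \<longleftrightarrow>
     (\<forall>x. L2_set (\<lambda>i. \<Sum>l<m. B i l * x l) {..<n} \<le> c * L2_set x {..<m})"

lemma op_bounded_cong:
  assumes "op_bounded n m B c" "\<And>i l. i < n \<Longrightarrow> l < m \<Longrightarrow> B i l = B' i l"
  shows "op_bounded n m B' c"
proof -
  have "L2_set (\<lambda>i. \<Sum>l<m. B' i l * x l) {..<n} = L2_set (\<lambda>i. \<Sum>l<m. B i l * x l) {..<n}" for x
    by (rule L2_set_cong) (use assms(2) in auto)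
  with assms(1) show ?thesis unfolding op_bounded_def by simp
qed

lemma op_bounded_mono:
  assumes "op_bounded n m B c" "c \<le> c'"
  shows "op_bounded n m B c'"
  using assms unfolding op_bounded_def
  by (meson L2_set_nonneg mult_right_mono order_trans)

lemma op_bounded_add:
  assumes "op_bounded n m B c" "op_bounded n m B' c'"
  shows "op_bounded n m (\<lambda>i l. B i l + B' i l) (c + c')"
  unfolding op_bounded_def
proof
  fix x
  have "L2_set (\<lambda>i. \<Sum>l<m. (B i l + B' i l) * x l) {..<n}
      = L2_set (\<lambda>i. (\<Sum>l<m. B i l * x l) + (\<Sum>l<m. B' i l * x l)) {..<n}"
    by (simp add: distrib_right sum.distrib)
  also have "\<dots> \<le> L2_set (\<lambda>i. \<Sum>l<m. B i l * x l) {..<n} + L2_set (\<lambda>i. \<Sum>l<m. B' i l * x l) {..<n}"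
    by (rule L2_set_triangle_ineq)
  also have "\<dots> \<le> (c + c') * L2_set x {..<m}"
    using assms unfolding op_bounded_def distrib_right by (intro add_mono) auto
  finally show "L2_set (\<lambda>i. \<Sum>l<m. (B i l + B' i l) * x l) {..<n} \<le> (c + c') * L2_set x {..<m}" .
qed

lemma op_bounded_sum:
  assumes "finite J" "\<And>j. j \<in> J \<Longrightarrow> op_bounded n m (B j) c"
  shows "op_bounded n m (\<lambda>i l. \<Sum>j\<in>J. B j i l) (real (card J) * c)"
  using assms
proof (induction J rule: finite_induct)
  case empty
  then show ?case by (simp add: op_bounded_def L2_set_0')
next
  case (insert j J)
  have "op_bounded n m (\<lambda>i l. B j i l + (\<Sum>j\<in>J. B j i l)) (c + real (card J) * c)"
    by (rule op_bounded_add) (use insert in auto)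
  then show ?case using insert by (simp add: distrib_right)
qed

text \<open>The image of \<open>x\<close> is a multiple of \<open>u\<close>, whose coefficient is an
  inner product with \<open>v\<close> and obeys Cauchy-Schwarz.\<close>

lemma op_bounded_rank_one: "op_bounded n m (\<lambda>i l. u i * v l) (L2_set u {..<n} * L2_set v {..<m})"
  unfolding op_bounded_def
proof
  fix x
  have "L2_set (\<lambda>i. \<Sum>l<m. u i * v l * x l) {..<n} = L2_set (\<lambda>i. (\<Sum>l<m. v l * x l) * u i) {..<n}"
    by (simp add: sum_distrib_left mult_ac)
  also have "\<dots> = \<bar>\<Sum>l<m. v l * x l\<bar> * L2_set u {..<n}"
    unfolding L2_set_def by (simp add: power_mult_distrib sum_distrib_left[symmetric] real_sqrt_mult)
  also have "\<dots> \<le> L2_set v {..<m} * L2_set x {..<m} * L2_set u {..<n}"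
    by (intro mult_right_mono abs_sum_mult_le_L2_set) simp
  finally show "L2_set (\<lambda>i. \<Sum>l<m. u i * v l * x l) {..<n}
      \<le> L2_set u {..<n} * L2_set v {..<m} * L2_set x {..<m}" by (simp add: mult_ac)
qed

text \<open>Cauchy-Schwarz in each row bounds every coordinate of the image by
  \<open>sqrt m * b\<close> times the norm of \<open>x\<close>, and there are \<open>n\<close>
  coordinates. This settles the case \<open>\<gamma> \<ge> 1/7\<close>.\<close>

lemma op_bounded_max:
  assumes "\<And>i l. i < n \<Longrightarrow> l < m \<Longrightarrow> \<bar>B i l\<bar> \<le> b" "b \<ge> 0"
  shows "op_bounded n m B (sqrt (real n * real m) * b)"
  unfolding op_bounded_def
proof
  fix x
  have "\<bar>\<Sum>l<m. B i l * x l\<bar> \<le> sqrt (real m) * b * L2_set x {..<m}" if "i < n" for i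
    by (rule order_trans[OF abs_sum_mult_le_L2_set])
      (use assms that in \<open>auto intro!: mult_right_mono L2_set_le_bound\<close>)
  then have "L2_set (\<lambda>i. \<Sum>l<m. B i l * x l) {..<n}
      \<le> sqrt (real n) * (sqrt (real m) * b * L2_set x {..<m})"
    by (rule L2_set_le_bound) (use assms(2) in auto)
  then show "L2_set (\<lambda>i. \<Sum>l<m. B i l * x l) {..<n} \<le> sqrt (real n * real m) * b * L2_set x {..<m}"
    by (simp add: real_sqrt_mult mult_ac)
qed

section \<open>From operator bounds to the spectral norm\<close>

lemma gram_mult_vec_index:
  fixes B :: "real mat"
  assumes B: "B \<in> carrier_mat n m" and y: "y \<in> carrier_vec m" and l: "l < m"
  shows "((transpose_mat B * B) *\<^sub>v y) $ l = (\<Sum>p<m. (\<Sum>i<n. B $$ (i, l) * B $$ (i, p)) * y $ p)"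
proof -
  have "((transpose_mat B * B) *\<^sub>v y) $ l = (\<Sum>i<n. \<Sum>p<m. B $$ (i, l) * B $$ (i, p) * y $ p)"
    using assms by (simp add: scalar_prod_def lessThan_atLeast0 sum_distrib_left mult.assoc)
  also have "\<dots> = (\<Sum>p<m. (\<Sum>i<n. B $$ (i, l) * B $$ (i, p)) * y $ p)"
    unfolding sum_distrib_right by (rule sum.swap)
  finally show ?thesis .
qed

text \<open>If \<open>y\<close> is an eigenvector of the Gram matrix for \<open>a\<close>, then the
  squared norm of \<open>B y\<close> is \<open>a\<close> times that of \<open>y\<close>, so
  \<open>a\<close> is at most the square of \<open>c\<close>. For \<open>Max\<close> to be
  meaningful the set must also be finite and nonempty; the latter comes from a real eigenpair of the
  symmetric Gram matrix.\<close>

lemma spectral_norm_le: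
  fixes B :: "real mat"
  assumes B: "B \<in> carrier_mat n m" and m: "m > 0"
    and c: "op_bounded n m (\<lambda>i l. B $$ (i, l)) c" "c \<ge> 0"
  shows "spectral_norm B \<le> c"
proof -
  let ?G = "transpose_mat B * B"
  have G: "?G \<in> carrier_mat m m" using B by auto
  have fin: "finite (singular_values B)"
    using card_finite_spectrum(1)[OF G] unfolding singular_values_def spectrum_def by simp
  define S where "S l p = (\<Sum>i<n. B $$ (i, l) * B $$ (i, p))" for l p
  obtain e v where v: "(\<Sum>l<m. (v l)\<^sup>2) = 1" and ev: "\<And>l. l < m \<Longrightarrow> (\<Sum>p<m. S l p * v p) = e * v l"
    by (rule symmetric_real_eigenpair[OF m, of S]) (auto simp: S_def mult.commute)
  have "eigenvector ?G (vec m v) e"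
    unfolding eigenvector_def
  proof (intro conjI)
    show "vec m v \<in> carrier_vec (dim_row ?G)" using B by simp
    show "vec m v \<noteq> 0\<^sub>v (dim_row ?G)"
    proof
      assume "vec m v = 0\<^sub>v (dim_row ?G)"
      then have "v l = 0" if "l < m" for l
        using that carrier_matD(1)[OF G] by (metis index_vec index_zero_vec(1))
      then show False using v by simp
    qed
    show "?G *\<^sub>v vec m v = e \<cdot>\<^sub>v vec m v"
    proof (rule eq_vecI)
      show "(?G *\<^sub>v vec m v) $ l = (e \<cdot>\<^sub>v vec m v) $ l" if "l < dim_vec (e \<cdot>\<^sub>v vec m v)" for l
        using gram_mult_vec_index[OF B, of "vec m v" l] ev[of l] that by (simp add: S_def)
    qed (use B in auto)
  qed
  then have ne: "singular_values B \<noteq> {}"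
    unfolding singular_values_def eigenvalue_def by auto
  have "s \<le> c" if s: "s \<in> singular_values B" for s
  proof -
    from s obtain a y where sa: "s = sqrt a" and y: "y \<in> carrier_vec m" "y \<noteq> 0\<^sub>v m"
      and ya: "?G *\<^sub>v y = a \<cdot>\<^sub>v y"
      unfolding singular_values_def eigenvalue_def eigenvector_def using B by auto
    define t where "t = (\<Sum>l<m. (y $ l)\<^sup>2)"
    from y obtain l0 where l0: "l0 < m" "y $ l0 \<noteq> 0"
      by (metis carrier_vecD eq_vecI index_zero_vec(1) index_zero_vec(2))
    have t: "t > 0" unfolding t_def by (rule sum_pos2[of _ l0]) (use l0 in auto)
    \<comment> \<open>The squared norm of \<open>B y\<close> is rewritten as the inner product of
      \<open>y\<close> with the Gram matrix applied to \<open>y\<close>.\<close>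
    have "(\<Sum>i<n. (\<Sum>l<m. B $$ (i, l) * y $ l)\<^sup>2)
        = (\<Sum>i<n. \<Sum>l<m. \<Sum>p<m. (B $$ (i, l) * y $ l) * (B $$ (i, p) * y $ p))"
      unfolding power2_eq_square sum_product ..
    also have "\<dots> = (\<Sum>l<m. \<Sum>p<m. \<Sum>i<n. (B $$ (i, l) * y $ l) * (B $$ (i, p) * y $ p))"
      by (subst sum.swap, rule sum.cong[OF refl], rule sum.swap)
    also have "\<dots> = (\<Sum>l<m. y $ l * (\<Sum>p<m. S l p * y $ p))"
      unfolding S_def sum_distrib_left sum_distrib_right by (intro sum.cong refl) (simp add: mult_ac)
    also have "\<dots> = (\<Sum>l<m. y $ l * (a * y $ l))"
    proof (intro sum.cong refl)
      fix l assume "l \<in> {..<m}"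
      then show "y $ l * (\<Sum>p<m. S l p * y $ p) = y $ l * (a * y $ l)"
        using gram_mult_vec_index[OF B y(1), of l] y(1) unfolding ya S_def by simp
    qed
    also have "\<dots> = a * t" unfolding t_def sum_distrib_left by (simp add: power2_eq_square mult_ac)
    finally have "(L2_set (\<lambda>i. \<Sum>l<m. B $$ (i, l) * y $ l) {..<n})\<^sup>2 = a * t"
      unfolding L2_set_power2 .
    moreover have "(L2_set (\<lambda>i. \<Sum>l<m. B $$ (i, l) * y $ l) {..<n})\<^sup>2 \<le> (c * L2_set (\<lambda>l. y $ l) {..<m})\<^sup>2"
      using c unfolding op_bounded_def by (intro power_mono) auto
    moreover have "(c * L2_set (\<lambda>l. y $ l) {..<m})\<^sup>2 = c\<^sup>2 * t"
      unfolding power_mult_distrib L2_set_power2 t_def ..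
    ultimately have "a \<le> c\<^sup>2" using t by simp
    then show "s \<le> c" unfolding sa using c(2) by (simp add: real_le_lsqrt)
  qed
  then show ?thesis unfolding spectral_norm_def using fin ne by simp
qed

section \<open>Block structure from level sets, and the maximum norm\<close>

text \<open>The level sets of \<open>f\<close> and \<open>g\<close> partition the rows and columns,
  one part for each value attained, and an entry depends only on the two values.\<close>

lemma block_matrixI:
  fixes f :: "nat \<Rightarrow> 'a" and g :: "nat \<Rightarrow> 'b"
  assumes B: "B \<in> carrier_mat n m"
    and entries: "\<And>i l. i < n \<Longrightarrow> l < m \<Longrightarrow> B $$ (i, l) = F (f i) (g l)"
    and K: "real (card (f ` {..<n}) * card (g ` {..<m})) \<le> K"
  shows "block_matrix B K"
proof -
  have part: "partition_on {..<k} ((\<lambda>y. {i \<in> {..<k}. h i = y}) ` h ` {..<k})" for k and h :: "nat \<Rightarrow> 'c"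
    unfolding partition_on_def disjoint_def by auto
  let ?R = "(\<lambda>y. {i \<in> {..<n}. f i = y}) ` f ` {..<n}"
  let ?C = "(\<lambda>y. {i \<in> {..<m}. g i = y}) ` g ` {..<m}"
  have "card ?R * card ?C \<le> card (f ` {..<n}) * card (g ` {..<m})"
    by (intro mult_mono card_image_le) auto
  then have "real (card ?R * card ?C) \<le> K" using K by linarith
  moreover have "\<forall>r\<in>?R. \<forall>c\<in>?C. \<exists>x. \<forall>i\<in>r. \<forall>j\<in>c. B $$ (i, j) = x"
    using entries by (auto 4 4)
  ultimately show ?thesis
    unfolding block_matrix_def using part[of n f] part[of m g] B by (intro exI[of _ ?R] exI[of _ ?C]) auto
qed

lemma max_norm_le:
  assumes "B \<in> carrier_mat n m" "n > 0" "m > 0"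
    and "\<And>i l. i < n \<Longrightarrow> l < m \<Longrightarrow> \<bar>B $$ (i, l)\<bar> \<le> c"
  shows "max_norm B \<le> c"
proof -
  have *: "{\<bar>B $$ (i, j)\<bar> | i j. i < dim_row B \<and> j < dim_col B}
      = (\<lambda>(i, j). \<bar>B $$ (i, j)\<bar>) ` ({..<n} \<times> {..<m})"
    using assms(1) by auto
  show ?thesis unfolding max_norm_def * using assms by (subst Max_le_iff) auto
qed

section \<open>The truncated singular value decomposition\<close>

lemma truncated_svd:
  fixes A :: "nat \<Rightarrow> nat \<Rightarrow> real"
  assumes n: "n > 0" and m: "m > 0" and L: "L > 0" and g: "0 < \<gamma>"
    and A: "\<And>i l. i < n \<Longrightarrow> l < m \<Longrightarrow> \<bar>A i l\<bar> \<le> L"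
  obtains J :: "nat set" and w v where
    "finite J" "real (card J) \<le> 1 / \<gamma>\<^sup>2"
    "op_bounded n m (\<lambda>i l. A i l - (\<Sum>j\<in>J. w j i * v j l)) (\<gamma> * sqrt (real n * real m) * L)"
    "\<forall>j\<in>J. \<forall>i<n. \<bar>w j i\<bar> \<le> sqrt (real m) * L"
    "\<forall>j\<in>J. \<forall>l<m. \<bar>v j l\<bar> \<le> 1 / (\<gamma> * sqrt (real m))"
    "\<forall>j\<in>J. L2_set (v j) {..<m} = 1"
proof -
  define S where "S l p = (\<Sum>i<n. A i l * A i p)" for l p
  obtain V e where V: "\<And>i j. i < m \<Longrightarrow> j < m \<Longrightarrow> (\<Sum>l<m. V i l * V j l) = of_bool (i = j)"
    and V': "\<And>l p. l < m \<Longrightarrow> p < m \<Longrightarrow> (\<Sum>j<m. V j l * V j p) = of_bool (l = p)"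
    and ev: "\<And>j l. j < m \<Longrightarrow> l < m \<Longrightarrow> (\<Sum>p<m. S l p * V j p) = e j * V j l"
    by (rule real_spectral_theorem[of m S]) (auto simp: S_def mult.commute)
  define w where "w j i = (\<Sum>p<m. A i p * V j p)" for j i
  define c where "c = \<gamma> * sqrt (real n * real m) * L"
  have c: "c > 0" unfolding c_def using n m L g by simp
  have c2: "c\<^sup>2 = \<gamma>\<^sup>2 * (real n * real m * L\<^sup>2)"
    unfolding c_def by (simp add: power_mult_distrib mult_ac)
  \<comment> \<open>The eigenvalue \<open>e j\<close> is the squared norm of \<open>w j\<close>, so
    \<open>J\<close> collects the singular values above the threshold \<open>c\<close>.\<close>
  define J where "J = {j. j < m \<and> e j > c\<^sup>2}"
  have J: "finite J" "J \<subseteq> {..<m}" unfolding J_def by auto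
  have vnorm: "L2_set (V j) {..<m} = 1" if "j < m" for j
    using V[OF that that] unfolding L2_set_def by (simp add: power2_eq_square)
  have Aw: "(\<Sum>i<n. A i l * w j i) = e j * V j l" if "j < m" "l < m" for j l
  proof -
    have "(\<Sum>i<n. A i l * w j i) = (\<Sum>i<n. \<Sum>p<m. A i l * A i p * V j p)"
      unfolding w_def sum_distrib_left by (simp only: mult.assoc)
    also have "\<dots> = (\<Sum>p<m. S l p * V j p)"
      unfolding S_def sum_distrib_right by (rule sum.swap)
    finally show ?thesis using ev[OF that] by simp
  qed
  \<comment> \<open>The images \<open>w j = A v_j\<close> inherit orthogonality from the
    eigenvectors, since the transpose of \<open>A\<close> takes \<open>w j\<close> to
    \<open>e j\<close> times \<open>V j\<close>.\<close>
  have ww: "(\<Sum>i<n. w j i * w k i) = e j * of_bool (j = k)" if "j < m" "k < m" for j k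
  proof -
    have "(\<Sum>i<n. w j i * w k i) = (\<Sum>i<n. \<Sum>p<m. V k p * (A i p * w j i))"
      by (intro sum.cong refl, subst w_def[of k]) (simp add: sum_distrib_left mult_ac)
    also have "\<dots> = (\<Sum>p<m. V k p * (\<Sum>i<n. A i p * w j i))"
      unfolding sum_distrib_left by (rule sum.swap)
    also have "\<dots> = (\<Sum>p<m. e j * (V j p * V k p))"
      by (intro sum.cong refl) (simp add: Aw[OF that(1)])
    also have "\<dots> = e j * of_bool (j = k)"
      unfolding sum_distrib_left[symmetric] V[OF that] ..
    finally show ?thesis .
  qed
  have wnorm: "(L2_set (w j) {..<n})\<^sup>2 = e j" if "j < m" for j
    using ww[OF that that] unfolding L2_set_power2 by (simp add: power2_eq_square)
  have e0: "e j \<ge> 0" if "j < m" for j using wnorm[OF that] by (metis zero_le_power2)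
  have expand: "(\<Sum>j<m. w j i * V j l) = A i l" if "l < m" for i l
  proof -
    have "(\<Sum>j<m. w j i * V j l) = (\<Sum>j<m. \<Sum>p<m. A i p * (V j p * V j l))"
      unfolding w_def sum_distrib_right by (simp only: mult.assoc)
    also have "\<dots> = (\<Sum>p<m. A i p * (\<Sum>j<m. V j p * V j l))"
      unfolding sum_distrib_left by (rule sum.swap)
    also have "\<dots> = (\<Sum>p<m. A i p * of_bool (p = l))"
      by (intro sum.cong refl) (simp add: V' that)
    also have "\<dots> = A i l" by (rule sum_delta_mult[OF that])
    finally show ?thesis .
  qed
  have parseval: "(\<Sum>j<m. (\<Sum>l<m. V j l * x l)\<^sup>2) = (\<Sum>l<m. (x l)\<^sup>2)" for x
  proof -
    have "(\<Sum>j<m. (\<Sum>l<m. V j l * x l)\<^sup>2) = (\<Sum>j<m. \<Sum>l<m. \<Sum>p<m. V j l * x l * (V j p * x p))"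
      unfolding power2_eq_square sum_product ..
    also have "\<dots> = (\<Sum>l<m. \<Sum>p<m. \<Sum>j<m. V j l * x l * (V j p * x p))"
      by (subst sum.swap, rule sum.cong[OF refl], rule sum.swap)
    also have "\<dots> = (\<Sum>l<m. \<Sum>p<m. (\<Sum>j<m. V j l * V j p) * (x l * x p))"
      unfolding sum_distrib_right by (simp only: mult_ac)
    also have "\<dots> = (\<Sum>l<m. \<Sum>p<m. of_bool (l = p) * (x l * x p))"
      by (intro sum.cong refl) (simp add: V')
    also have "\<dots> = (\<Sum>l<m. (x l)\<^sup>2)"
      by (intro sum.cong refl) (simp add: sum_delta_mult power2_eq_square)
    finally show ?thesis .
  qed
  show thesis
  proof
    show "finite J" by fact
    \<comment> \<open>Each index in \<open>J\<close> contributes more than the square of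
      \<open>c\<close> to the sum of all \<open>e j\<close>, which is the squared Frobenius norm of
      \<open>A\<close>.\<close>
    have "real (card J) * c\<^sup>2 \<le> (\<Sum>j\<in>J. e j)"
      using sum_bounded_below[of J "c\<^sup>2" e] unfolding J_def by auto
    also have "\<dots> \<le> (\<Sum>j<m. e j)" by (rule sum_mono2) (use J e0 in auto)
    also have "\<dots> = (\<Sum>j<m. \<Sum>i<n. (w j i)\<^sup>2)"
      by (intro sum.cong refl) (use wnorm in \<open>auto simp: L2_set_power2\<close>)
    \<comment> \<open>Parseval will be applied to each row of \<open>A\<close> separately.\<close>
    also have "\<dots> = (\<Sum>i<n. \<Sum>j<m. (\<Sum>l<m. V j l * A i l)\<^sup>2)"
      by (subst sum.swap) (simp add: w_def mult.commute)
    also have "\<dots> = (\<Sum>i<n. \<Sum>l<m. (A i l)\<^sup>2)" unfolding parseval ..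
    also have "\<dots> \<le> (\<Sum>i<n. \<Sum>l<m. L\<^sup>2)"
      by (intro sum_mono) (use A in \<open>auto simp: abs_le_square_iff[symmetric] L less_imp_le\<close>)
    also have "\<dots> = real n * real m * L\<^sup>2" by simp
    finally have "(real (card J) * \<gamma>\<^sup>2) * (real n * real m * L\<^sup>2) \<le> 1 * (real n * real m * L\<^sup>2)"
      unfolding c2 by (simp add: mult_ac)
    then have "real (card J) * \<gamma>\<^sup>2 \<le> 1" using n m L by (subst (asm) mult_le_cancel_right) auto
    then show "real (card J) \<le> 1 / \<gamma>\<^sup>2" using g by (simp add: field_simps)
    have w_bound: "\<bar>w j i\<bar> \<le> sqrt (real m) * L" if "j \<in> J" "i < n" for j i
    proof -
      have "\<bar>w j i\<bar> \<le> L2_set (A i) {..<m} * L2_set (V j) {..<m}"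
        unfolding w_def by (rule abs_sum_mult_le_L2_set)
      also have "\<dots> \<le> sqrt (real m) * L"
        using L2_set_le_bound[of m "A i" L] A[OF that(2)] L vnorm[of j] that J by auto
      finally show ?thesis .
    qed
    show "\<forall>j\<in>J. L2_set (V j) {..<m} = 1" using vnorm J by auto
    have V_bound: "\<bar>V j l\<bar> \<le> 1 / (\<gamma> * sqrt (real m))" if "j \<in> J" "l < m" for j l
    proof -
      have j: "j < m" "e j > c\<^sup>2" using that unfolding J_def by auto
      define s where "s = L2_set (w j) {..<n}"
      have es: "e j = s\<^sup>2" using wnorm[OF j(1)] unfolding s_def by simp
      have sc: "s > c" using j(2) unfolding es by (rule power2_less_imp_less) (simp add: s_def)
      \<comment> \<open>The entry \<open>V j l\<close> is read off from the inner product of column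
        \<open>l\<close> of \<open>A\<close> with \<open>w j\<close>. Cauchy-Schwarz costs only one
        factor \<open>s\<close>, and the other satisfies \<open>s > c\<close>.\<close>
      have "s\<^sup>2 * \<bar>V j l\<bar> = \<bar>\<Sum>i<n. A i l * w j i\<bar>"
        unfolding Aw[OF j(1) that(2)] es by (simp add: abs_mult)
      also have "\<dots> \<le> L2_set (\<lambda>i. A i l) {..<n} * s"
        unfolding s_def by (rule abs_sum_mult_le_L2_set)
      also have "\<dots> \<le> sqrt (real n) * L * s"
        by (intro mult_right_mono L2_set_le_bound) (use A that L in \<open>auto simp: s_def\<close>)
      finally have "s * (s * \<bar>V j l\<bar>) \<le> s * (sqrt (real n) * L)"
        by (simp add: power2_eq_square mult_ac)
      then have "s * \<bar>V j l\<bar> \<le> sqrt (real n) * L" using sc c by simp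
      moreover have "c * \<bar>V j l\<bar> \<le> s * \<bar>V j l\<bar>" using sc by (intro mult_right_mono) auto
      ultimately have "(\<gamma> * sqrt (real m) * \<bar>V j l\<bar>) * (sqrt (real n) * L) \<le> 1 * (sqrt (real n) * L)"
        unfolding c_def real_sqrt_mult by (simp add: mult_ac)
      then have "\<gamma> * sqrt (real m) * \<bar>V j l\<bar> \<le> 1" using n L by (subst (asm) mult_le_cancel_right) auto
      then show ?thesis using g m by (simp add: field_simps)
    qed
    show "\<forall>j\<in>J. \<forall>i<n. \<bar>w j i\<bar> \<le> sqrt (real m) * L" using w_bound by simp
    show "\<forall>j\<in>J. \<forall>l<m. \<bar>V j l\<bar> \<le> 1 / (\<gamma> * sqrt (real m))" using V_bound by simp
    show "op_bounded n m (\<lambda>i l. A i l - (\<Sum>j\<in>J. w j i * V j l)) (\<gamma> * sqrt (real n * real m) * L)"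
      unfolding op_bounded_def c_def[symmetric]
    proof
      fix x
      define y where "y j = (\<Sum>l<m. V j l * x l)" for j
      define I where "I = {..<m} - J"
      have I: "j < m" "e j \<le> c\<^sup>2" if "j \<in> I" for j using that unfolding I_def J_def by auto
      have finI: "finite I" unfolding I_def by simp
      have rest: "A i l - (\<Sum>j\<in>J. w j i * V j l) = (\<Sum>j\<in>I. w j i * V j l)" if "l < m" for i l
        using expand[OF that, of i] sum.subset_diff[OF J(2), of "\<lambda>j. w j i * V j l"] unfolding I_def by simp
      have app: "(\<Sum>l<m. (A i l - (\<Sum>j\<in>J. w j i * V j l)) * x l) = (\<Sum>j\<in>I. w j i * y j)" for i
      proof -
        have "(\<Sum>l<m. (A i l - (\<Sum>j\<in>J. w j i * V j l)) * x l) = (\<Sum>l<m. \<Sum>j\<in>I. w j i * (V j l * x l))"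
          by (intro sum.cong refl) (simp add: rest sum_distrib_right mult.assoc)
        also have "\<dots> = (\<Sum>j\<in>I. w j i * y j)"
          unfolding y_def sum_distrib_left by (rule sum.swap)
        finally show ?thesis .
      qed
      \<comment> \<open>Orthogonality of the \<open>w j\<close> removes the cross terms; the
        discarded \<open>e j\<close> are at most the square of \<open>c\<close>, and Parseval sums
        the squared coefficients \<open>y j\<close>.\<close>
      have "(L2_set (\<lambda>i. \<Sum>j\<in>I. w j i * y j) {..<n})\<^sup>2
          = (\<Sum>i<n. \<Sum>j\<in>I. \<Sum>k\<in>I. w j i * y j * (w k i * y k))"
        unfolding L2_set_power2 unfolding power2_eq_square sum_product ..
      also have "\<dots> = (\<Sum>j\<in>I. \<Sum>k\<in>I. \<Sum>i<n. w j i * y j * (w k i * y k))"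
        by (subst sum.swap, rule sum.cong[OF refl], rule sum.swap)
      also have "\<dots> = (\<Sum>j\<in>I. \<Sum>k\<in>I. (\<Sum>i<n. w j i * w k i) * (y j * y k))"
        unfolding sum_distrib_right by (simp only: mult_ac)
      also have "\<dots> = (\<Sum>j\<in>I. \<Sum>k\<in>I. if j = k then e j * (y j)\<^sup>2 else 0)"
        by (intro sum.cong refl) (simp add: ww I power2_eq_square)
      also have "\<dots> = (\<Sum>j\<in>I. e j * (y j)\<^sup>2)"
        by (intro sum.cong refl) (simp add: finI)
      also have "\<dots> \<le> (\<Sum>j\<in>I. c\<^sup>2 * (y j)\<^sup>2)"
        by (intro sum_mono mult_right_mono) (use I in auto)
      also have "\<dots> \<le> (\<Sum>j<m. c\<^sup>2 * (y j)\<^sup>2)"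
        by (rule sum_mono2) (auto simp: I_def)
      also have "\<dots> = (c * L2_set x {..<m})\<^sup>2"
        unfolding power_mult_distrib L2_set_power2 sum_distrib_left[symmetric] y_def parseval ..
      finally show "L2_set (\<lambda>i. \<Sum>l<m. (A i l - (\<Sum>j\<in>J. w j i * V j l)) * x l) {..<n} \<le> c * L2_set x {..<m}"
        unfolding app by (rule power2_le_imp_le) (use c in auto)
    qed
  qed
qed

section \<open>Rounding to a grid\<close>

lemma abs_floor_rounding:
  fixes x d :: real
  assumes "d > 0"
  shows "\<bar>x - d * of_int \<lfloor>x / d\<rfloor>\<bar> \<le> d"
proof -
  have "of_int \<lfloor>x / d\<rfloor> \<le> x / d" "x / d \<le> of_int \<lfloor>x / d\<rfloor> + 1" by linarith+
  then have "d * of_int \<lfloor>x / d\<rfloor> \<le> d * (x / d)" "d * (x / d) \<le> d * (of_int \<lfloor>x / d\<rfloor> + 1)"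
    using assms by (simp_all only: mult_left_mono less_imp_le)
  then show ?thesis using assms by (simp add: distrib_left abs_le_iff)
qed

text \<open>The code of an index is the tuple of its rounded entries, one for each \<open>j\<close>.
  Every component lies among the integers from \<open>\<lfloor>- M / d\<rfloor>\<close> to
  \<open>\<lfloor>M / d\<rfloor>\<close>; restricting to \<open>J\<close> makes the codes elements
  of a finite product.\<close>

lemma card_floor_codes_le:
  fixes x :: "'j \<Rightarrow> nat \<Rightarrow> real"
  assumes J: "finite J" and b: "\<And>j i. j \<in> J \<Longrightarrow> i < n \<Longrightarrow> \<bar>x j i\<bar> \<le> M"
    and d: "d > 0" and M: "M \<ge> 0"
  shows "real (card ((\<lambda>i. restrict (\<lambda>j. \<lfloor>x j i / d\<rfloor>) J) ` {..<n})) \<le> (2 * M / d + 2) ^ card J"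
proof -
  let ?Z = "{\<lfloor>- M / d\<rfloor>..\<lfloor>M / d\<rfloor>}"
  have "(\<lambda>i. restrict (\<lambda>j. \<lfloor>x j i / d\<rfloor>) J) ` {..<n} \<subseteq> (\<Pi>\<^sub>E j\<in>J. ?Z)"
  proof (intro image_subsetI PiE_I)
    fix i j assume ij: "i \<in> {..<n}" "j \<in> J"
    then have "- M / d \<le> x j i / d" "x j i / d \<le> M / d"
      using b[of j i] d by (intro divide_right_mono; simp)+
    then show "restrict (\<lambda>j. \<lfloor>x j i / d\<rfloor>) J j \<in> ?Z"
      using ij by (simp add: floor_mono del: minus_divide_left)
  qed simp
  then have "card ((\<lambda>i. restrict (\<lambda>j. \<lfloor>x j i / d\<rfloor>) J) ` {..<n}) \<le> card (\<Pi>\<^sub>E j\<in>J. ?Z)"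
    by (rule card_mono[rotated]) (simp add: J finite_PiE)
  also have "\<dots> = card ?Z ^ card J" by (simp add: card_PiE J)
  finally have "real (card ((\<lambda>i. restrict (\<lambda>j. \<lfloor>x j i / d\<rfloor>) J) ` {..<n})) \<le> real (card ?Z) ^ card J"
    by (metis of_nat_le_iff of_nat_power)
  also have "real (card ?Z) \<le> 2 * M / d + 2"
  proof -
    have "0 \<le> M / d" using d M by simp
    then have "real (card ?Z) = of_int (\<lfloor>M / d\<rfloor> + 1 - \<lfloor>- (M / d)\<rfloor>)"
      by (simp add: floor_mono minus_divide_left[symmetric])
    then show ?thesis by simp linarith
  qed
  then have "real (card ?Z) ^ card J \<le> (2 * M / d + 2) ^ card J" by (intro power_mono) auto
  finally show ?thesis .
qed

text \<open>The bases on the left are the grid sizes for the rows and columns. As \<open>g\<close>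
  is below 1 each additive 2 is absorbed by doubling, so their product is at most
  \<open>16 * g ^ 3 / g ^ 10\<close>, and \<open>16 * g ^ 3 < 1\<close> since
  \<open>g < 1/7\<close>.\<close>

lemma block_count_bound:
  fixes g :: real
  assumes g: "0 < g" "g < 1/7" and k: "real k \<le> 1 / g\<^sup>2"
  shows "(2 / g ^ 3 + 2) ^ k * (2 / g ^ 4 + 2) ^ k \<le> (1 / g ^ 10) powr (3 / g ^ 2)"
proof -
  have le1: "g ^ 3 \<le> 1" "g ^ 4 \<le> 1" "g ^ 10 \<le> 1" using g by (auto intro!: power_le_one)
  have g3: "g ^ 3 \<le> (1/7) ^ 3" using g by (intro power_mono) auto
  have "(2 / g ^ 3 + 2) * (2 / g ^ 4 + 2) \<le> (4 / g ^ 3) * (4 / g ^ 4)"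
    using g le1 by (intro mult_mono) (auto simp: field_simps)
  also have "\<dots> = 16 * g ^ 3 / g ^ 10"
    using g by (simp add: field_simps flip: power_add)
  also have "\<dots> \<le> 1 / g ^ 10"
    using g g3 by (intro divide_right_mono) (auto simp: power3_eq_cube)
  finally have "((2 / g ^ 3 + 2) * (2 / g ^ 4 + 2)) ^ k \<le> (1 / g ^ 10) ^ k"
    using g by (intro power_mono) auto
  also have "\<dots> = (1 / g ^ 10) powr real k" using g by (simp add: powr_realpow)
  also have "\<dots> \<le> (1 / g ^ 10) powr (3 / g ^ 2)"
  proof (rule powr_mono)
    have "1 / g\<^sup>2 \<le> 3 / g\<^sup>2" by (intro divide_right_mono) auto
    then show "real k \<le> 3 / g\<^sup>2" using k by simp
    show "1 \<le> 1 / g ^ 10" using le1 g by simp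
  qed
  finally show ?thesis by (simp add: power_mult_distrib)
qed

text \<open>The difference of two products is split as \<open>(w - w') v' + w (v - v')\<close>. As
  \<open>v'\<close> has norm at most \<open>1 + d \<le> 2\<close>, the two terms cost
  \<open>2 * d * K\<close> and \<open>d * K\<close>.\<close>

lemma sum_rank_one_rounding_error:
  fixes w v w' v' :: "'j \<Rightarrow> nat \<Rightarrow> real"
  assumes J: "finite J" and d: "d \<ge> 0" "d \<le> 1" and K: "K \<ge> 0"
    and w: "\<And>j. j \<in> J \<Longrightarrow> L2_set (w j) {..<n} \<le> K"
      "\<And>j. j \<in> J \<Longrightarrow> L2_set (\<lambda>i. w j i - w' j i) {..<n} \<le> d * K"
    and v: "\<And>j. j \<in> J \<Longrightarrow> L2_set (v j) {..<m} \<le> 1"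
      "\<And>j. j \<in> J \<Longrightarrow> L2_set (\<lambda>l. v j l - v' j l) {..<m} \<le> d"
  shows "op_bounded n m (\<lambda>i l. (\<Sum>j\<in>J. w j i * v j l) - (\<Sum>j\<in>J. w' j i * v' j l))
           (real (card J) * (3 * d * K))"
proof -
  have "op_bounded n m (\<lambda>i l. (w j i - w' j i) * v' j l + w j i * (v j l - v' j l)) (3 * d * K)"
    if j: "j \<in> J" for j
  proof -
    have "L2_set (v' j) {..<m} = L2_set (\<lambda>l. v j l + (v' j l - v j l)) {..<m}" by simp
    also have "\<dots> \<le> L2_set (v j) {..<m} + L2_set (\<lambda>l. v' j l - v j l) {..<m}"
      by (rule L2_set_triangle_ineq)
    also have "L2_set (\<lambda>l. v' j l - v j l) {..<m} = L2_set (\<lambda>l. v j l - v' j l) {..<m}"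
      unfolding L2_set_def by (simp add: power2_commute)
    finally have v': "L2_set (v' j) {..<m} \<le> 2" using v[OF j] d by linarith
    have "op_bounded n m (\<lambda>i l. (w j i - w' j i) * v' j l) (d * K * 2)"
      by (rule op_bounded_mono[OF op_bounded_rank_one]) (use w[OF j] v' d K in \<open>auto intro!: mult_mono\<close>)
    moreover have "op_bounded n m (\<lambda>i l. w j i * (v j l - v' j l)) (K * d)"
      by (rule op_bounded_mono[OF op_bounded_rank_one]) (use w[OF j] v[OF j] d K in \<open>auto intro!: mult_mono\<close>)
    ultimately show ?thesis using op_bounded_add by (fastforce simp: algebra_simps)
  qed
  from op_bounded_sum[OF J this] show ?thesis
    by (rule op_bounded_cong) (simp_all add: sum_subtractf[symmetric] algebra_simps)
qed

section \<open>The decomposition\<close>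

lemma small_gamma_decomposition:
  fixes A :: "real mat"
  assumes n: "n > 0" and m: "m > 0" and L: "L > 0" and g: "0 < \<gamma>" "\<gamma> < 1/7"
    and A: "A \<in> carrier_mat n m" "\<And>i l. i < n \<Longrightarrow> l < m \<Longrightarrow> \<bar>A $$ (i, l)\<bar> \<le> L"
  obtains B where "B \<in> carrier_mat n m"
    "block_matrix B ((1 / \<gamma> ^ 10) powr (3 / \<gamma> ^ 2))"
    "spectral_norm (A - B) \<le> 7 * \<gamma> * sqrt (real n * real m) * L"
    "max_norm B \<le> 2 / \<gamma> ^ 11 * L"
proof -
  define N where "N = sqrt (real n * real m)"
  have N: "N > 0" "N = sqrt (real n) * sqrt (real m)" unfolding N_def using n m by (auto simp: real_sqrt_mult)
  have sm: "sqrt (real m) > 0" using m by simp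
  have g3: "\<gamma> ^ 3 > 0" "\<gamma> ^ 3 \<le> 1" using g by (auto intro!: power_le_one)
  obtain J :: "nat set" and w v where J: "finite J" "real (card J) \<le> 1 / \<gamma>\<^sup>2"
    and rest: "op_bounded n m (\<lambda>i l. A $$ (i, l) - (\<Sum>j\<in>J. w j i * v j l)) (\<gamma> * N * L)"
    and w: "\<forall>j\<in>J. \<forall>i<n. \<bar>w j i\<bar> \<le> sqrt (real m) * L"
    and v: "\<forall>j\<in>J. \<forall>l<m. \<bar>v j l\<bar> \<le> 1 / (\<gamma> * sqrt (real m))"
    and v1: "\<forall>j\<in>J. L2_set (v j) {..<m} = 1"
    by (rule truncated_svd[of n m L \<gamma> "\<lambda>i l. A $$ (i, l)", folded N_def, OF n m L g(1)], rule A(2),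
        assumption, assumption, rule that, assumption+)
  note w = w[rule_format] and v = v[rule_format] and v1 = v1[rule_format]
  \<comment> \<open>The mesh \<open>a\<close> is relative to the entry bound of \<open>w\<close>.
    The mesh \<open>b\<close> is relative to \<open>1 / sqrt m\<close>, so that the rounding error
    of a unit vector has norm at most \<open>\<gamma> ^ 3\<close>; against the entry bound of
    \<open>v\<close> this gives \<open>2 / \<gamma> ^ 4 + 2\<close> grid values.\<close>
  define a where "a = \<gamma> ^ 3 * (sqrt (real m) * L)"
  define b where "b = \<gamma> ^ 3 / sqrt (real m)"
  have a: "a > 0" and b: "b > 0" unfolding a_def b_def using g3 sm L by auto
  define w' where "w' j i = a * of_int \<lfloor>w j i / a\<rfloor>" for j i
  define v' where "v' j l = b * of_int \<lfloor>v j l / b\<rfloor>" for j l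
  have ww': "\<bar>w j i - w' j i\<bar> \<le> a" for j i unfolding w'_def by (rule abs_floor_rounding[OF a])
  have vv': "\<bar>v j l - v' j l\<bar> \<le> b" for j l unfolding v'_def by (rule abs_floor_rounding[OF b])
  define B where "B = mat n m (\<lambda>(i, l). \<Sum>j\<in>J. w' j i * v' j l)"
  have B: "B \<in> carrier_mat n m" unfolding B_def by simp
  show thesis
  proof
    show "B \<in> carrier_mat n m" by fact
    let ?f = "\<lambda>i. restrict (\<lambda>j. \<lfloor>w j i / a\<rfloor>) J" and ?g = "\<lambda>l. restrict (\<lambda>j. \<lfloor>v j l / b\<rfloor>) J"
    show "block_matrix B ((1 / \<gamma> ^ 10) powr (3 / \<gamma> ^ 2))"
    proof (rule block_matrixI[OF B, where f = ?f and g = ?g])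
      show "B $$ (i, l) = (\<lambda>F G. \<Sum>j\<in>J. (a * of_int (F j)) * (b * of_int (G j))) (?f i) (?g l)"
        if "i < n" "l < m" for i l
        using that unfolding B_def w'_def v'_def by simp
      have "real (card (?f ` {..<n})) \<le> (2 / \<gamma> ^ 3 + 2) ^ card J"
        using card_floor_codes_le[OF J(1) w a] L sm g unfolding a_def by simp
      moreover have "real (card (?g ` {..<m})) \<le> (2 / \<gamma> ^ 4 + 2) ^ card J"
        using card_floor_codes_le[OF J(1) v b] sm g unfolding b_def by (simp add: power_numeral_reduce mult_ac)
      ultimately have "real (card (?f ` {..<n})) * real (card (?g ` {..<m}))
          \<le> (2 / \<gamma> ^ 3 + 2) ^ card J * (2 / \<gamma> ^ 4 + 2) ^ card J"
        using g by (intro mult_mono) auto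
      also have "\<dots> \<le> (1 / \<gamma> ^ 10) powr (3 / \<gamma> ^ 2)"
        by (rule block_count_bound[OF g J(2)])
      finally show "real (card (?f ` {..<n}) * card (?g ` {..<m})) \<le> (1 / \<gamma> ^ 10) powr (3 / \<gamma> ^ 2)"
        by simp
    qed
    have "op_bounded n m (\<lambda>i l. (\<Sum>j\<in>J. w j i * v j l) - (\<Sum>j\<in>J. w' j i * v' j l))
           (real (card J) * (3 * \<gamma> ^ 3 * (N * L)))"
    proof (rule sum_rank_one_rounding_error[OF J(1)])
      show "L2_set (w j) {..<n} \<le> N * L" if "j \<in> J" for j
        using L2_set_le_bound[of n "w j" "sqrt (real m) * L"] w[OF that] L by (simp add: N mult_ac)
      show "L2_set (\<lambda>i. w j i - w' j i) {..<n} \<le> \<gamma> ^ 3 * (N * L)" for j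
        using L2_set_le_bound[of n "\<lambda>i. w j i - w' j i", OF ww'] a by (simp add: N a_def mult_ac)
      show "L2_set (\<lambda>l. v j l - v' j l) {..<m} \<le> \<gamma> ^ 3" for j
        using L2_set_le_bound[of m "\<lambda>l. v j l - v' j l", OF vv'] b sm by (simp add: b_def)
    qed (use g3 N L v1 in auto)
    \<comment> \<open>The number of terms eats two of the three powers of \<open>\<gamma>\<close>,
      which is why the mesh is cubic.\<close>
    moreover have "real (card J) * (3 * \<gamma> ^ 3 * (N * L)) \<le> 3 * \<gamma> * N * L"
    proof -
      have "real (card J) * \<gamma>\<^sup>2 \<le> 1" using J(2) g by (simp add: field_simps)
      then have "(real (card J) * \<gamma>\<^sup>2) * (3 * \<gamma> * N * L) \<le> 1 * (3 * \<gamma> * N * L)"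
        using g N L by (intro mult_right_mono) auto
      then show ?thesis by (simp add: power2_eq_square power3_eq_cube mult_ac)
    qed
    ultimately have "op_bounded n m (\<lambda>i l. (\<Sum>j\<in>J. w j i * v j l) - (\<Sum>j\<in>J. w' j i * v' j l))
        (3 * \<gamma> * N * L)"
      by (rule op_bounded_mono)
    from op_bounded_add[OF rest this]
    \<comment> \<open>Truncation costs \<open>\<gamma> * N * L\<close> and rounding three times as
      much.\<close>
    have "op_bounded n m (\<lambda>i l. (A - B) $$ (i, l)) (\<gamma> * N * L + 3 * \<gamma> * N * L)"
      by (rule op_bounded_cong) (use A(1) B in \<open>simp add: B_def\<close>)
    then have "op_bounded n m (\<lambda>i l. (A - B) $$ (i, l)) (7 * \<gamma> * N * L)"
      by (rule op_bounded_mono) (use g N L in auto)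
    then show "spectral_norm (A - B) \<le> 7 * \<gamma> * sqrt (real n * real m) * L"
      unfolding N_def[symmetric] by (intro spectral_norm_le[of _ n m]) (use A(1) B m g N L in auto)
    show "max_norm B \<le> 2 / \<gamma> ^ 11 * L"
    proof (rule max_norm_le[OF B n m])
      fix i l assume il: "i < n" "l < m"
      \<comment> \<open>Both meshes are at most the corresponding entry bounds, so rounding at most
        doubles each bound.\<close>
      have "\<bar>w' j i * v' j l\<bar> \<le> 4 * L / \<gamma>" if j: "j \<in> J" for j
      proof -
        have "a \<le> sqrt (real m) * L" unfolding a_def using g3 sm L by (intro mult_left_le_one_le) auto
        then have 1: "\<bar>w' j i\<bar> \<le> 2 * (sqrt (real m) * L)"
          using ww'[of j i] w[OF j il(1)] by linarith
        have "\<gamma> ^ 3 * \<gamma> \<le> 1" using g g3 by (intro mult_le_one) auto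
        then have "b \<le> 1 / (\<gamma> * sqrt (real m))" unfolding b_def using g sm by (simp add: field_simps)
        then have 2: "\<bar>v' j l\<bar> \<le> 2 * (1 / (\<gamma> * sqrt (real m)))"
          using vv'[of j l] v[OF j il(2)] by linarith
        have "\<bar>w' j i\<bar> * \<bar>v' j l\<bar> \<le> (2 * (sqrt (real m) * L)) * (2 * (1 / (\<gamma> * sqrt (real m))))"
          using L by (intro mult_mono 1 2) auto
        also have "\<dots> = 4 * L / \<gamma>" using sm by simp
        finally show ?thesis by (simp add: abs_mult)
      qed
      then have "\<bar>B $$ (i, l)\<bar> \<le> real (card J) * (4 * L / \<gamma>)"
        using order_trans[OF sum_abs sum_bounded_above, of J "\<lambda>j. w' j i * v' j l" "4 * L / \<gamma>"] il
        by (simp add: B_def)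
      also have "\<dots> \<le> 1 / \<gamma>\<^sup>2 * (4 * L / \<gamma>)" using J(2) g L by (intro mult_right_mono) auto
      \<comment> \<open>The bound \<open>4 * L / \<gamma> ^ 3\<close> is brought to the required
        denominator; smallness of \<open>\<gamma>\<close> handles the numerator.\<close>
      also have "\<dots> = (4 * \<gamma> ^ 8) / \<gamma> ^ 11 * L"
        using g by (simp add: power_numeral_reduce)
      also have "\<dots> \<le> 2 / \<gamma> ^ 11 * L"
      proof -
        have "\<gamma> ^ 8 \<le> (1/7) ^ 8" using g by (intro power_mono) auto
        also have "\<dots> \<le> 1/2" by (simp add: power_divide)
        finally have "4 * \<gamma> ^ 8 \<le> 2" by linarith
        then show ?thesis using g L by (intro mult_right_mono divide_right_mono) simp_all
      qed
      finally show "\<bar>B $$ (i, l)\<bar> \<le> 2 / \<gamma> ^ 11 * L" .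
    qed
  qed
qed

theorem theorem3p1:
  shows "\<exists>C::real. C > 0 \<and>
    (\<forall>(n::nat) (m::nat) (L::real) (\<gamma>::real) (A::real mat).
       n \<ge> 1 \<longrightarrow> m \<ge> 1 \<longrightarrow> L > 0 \<longrightarrow> 0 < \<gamma> \<longrightarrow> \<gamma> < 1 \<longrightarrow>
       A \<in> carrier_mat n m \<longrightarrow>
       (\<forall>i<n. \<forall>j<m. A $$ (i, j) \<in> {-L..L}) \<longrightarrow>
       (let N = sqrt (real n * real m) in
        \<exists>Astr Apsd. Astr \<in> carrier_mat n m \<and> Apsd \<in> carrier_mat n m \<and>
          A = Astr + Apsd \<and>
          block_matrix Astr (C * (1 / \<gamma> ^ 10) powr (3 / \<gamma> ^ 2)) \<and>
          spectral_norm Apsd \<le> 7 * \<gamma> * N * L \<and>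
          max_norm Astr \<le> 2 / \<gamma> ^ 11 * L))"
\<comment> \<open>The constant \<open>C = 1\<close> works in both ranges of
  \<open>\<gamma>\<close>.\<close>
proof (intro exI[of _ 1] conjI allI impI)
  show "(1::real) > 0" by simp
  fix n m :: nat and L \<gamma> :: real and A :: "real mat"
  assume n: "n \<ge> 1" and m: "m \<ge> 1" and L: "L > 0" and g: "0 < \<gamma>" "\<gamma> < 1" and A: "A \<in> carrier_mat n m"
    and "\<forall>i<n. \<forall>j<m. A $$ (i, j) \<in> {-L..L}"
  then have AL: "\<bar>A $$ (i, l)\<bar> \<le> L" if "i < n" "l < m" for i l using that by force
  have "\<exists>B. B \<in> carrier_mat n m \<and> block_matrix B ((1 / \<gamma> ^ 10) powr (3 / \<gamma> ^ 2)) \<and>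
      spectral_norm (A - B) \<le> 7 * \<gamma> * sqrt (real n * real m) * L \<and> max_norm B \<le> 2 / \<gamma> ^ 11 * L"
  proof (cases "\<gamma> < 1/7")
    case True
    obtain B where "B \<in> carrier_mat n m" "block_matrix B ((1 / \<gamma> ^ 10) powr (3 / \<gamma> ^ 2))"
      "spectral_norm (A - B) \<le> 7 * \<gamma> * sqrt (real n * real m) * L" "max_norm B \<le> 2 / \<gamma> ^ 11 * L"
      by (rule small_gamma_decomposition[of n m L \<gamma> A]) (use n m L g True A AL in auto)
    then show ?thesis by blast
  next
    case False
    have "op_bounded n m (\<lambda>i l. A $$ (i, l)) (7 * \<gamma> * sqrt (real n * real m) * L)"
    proof (rule op_bounded_mono[OF op_bounded_max[of n m _ L]])
      have "1 * (sqrt (real n * real m) * L) \<le> (7 * \<gamma>) * (sqrt (real n * real m) * L)"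
        using False L by (intro mult_right_mono) auto
      then show "sqrt (real n * real m) * L \<le> 7 * \<gamma> * sqrt (real n * real m) * L" by (simp add: mult_ac)
    qed (use AL L in auto)
    moreover have "A - 0\<^sub>m n m = A" using A by auto
    ultimately have "spectral_norm (A - 0\<^sub>m n m) \<le> 7 * \<gamma> * sqrt (real n * real m) * L"
      using spectral_norm_le[OF A] m g L by simp
    moreover have "block_matrix (0\<^sub>m n m) ((1 / \<gamma> ^ 10) powr (3 / \<gamma> ^ 2))"
    \<comment> \<open>Constant labels put all rows into one part and all columns into one, a single
      block; the allowed count is at least 1 because \<open>\<gamma> < 1\<close>.\<close>
    proof (rule block_matrixI[where f = "\<lambda>_. 0 :: nat" and g = "\<lambda>_. 0 :: nat" and F = "\<lambda>_ _. 0"])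
      have "1 \<le> 1 / \<gamma> ^ 10" using g by (simp add: power_le_one)
      then have "1 \<le> (1 / \<gamma> ^ 10) powr (3 / \<gamma> ^ 2)" by (intro ge_one_powr_ge_zero) auto
      then show "real (card ((\<lambda>_. 0 :: nat) ` {..<n}) * card ((\<lambda>_. 0 :: nat) ` {..<m})) \<le> (1 / \<gamma> ^ 10) powr (3 / \<gamma> ^ 2)"
        using n m by (simp add: image_constant_conv lessThan_empty_iff)
    qed auto
    moreover have "max_norm (0\<^sub>m n m) \<le> 2 / \<gamma> ^ 11 * L"
      by (rule max_norm_le[of _ n m]) (use n m g L in auto)
    ultimately show ?thesis using zero_carrier_mat[of n m] by blast
  qed
  then obtain B where B: "B \<in> carrier_mat n m" "block_matrix B ((1 / \<gamma> ^ 10) powr (3 / \<gamma> ^ 2))"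
    "spectral_norm (A - B) \<le> 7 * \<gamma> * sqrt (real n * real m) * L" "max_norm B \<le> 2 / \<gamma> ^ 11 * L"
    by blast
  show "let N = sqrt (real n * real m) in
        \<exists>Astr Apsd. Astr \<in> carrier_mat n m \<and> Apsd \<in> carrier_mat n m \<and>
          A = Astr + Apsd \<and>
          block_matrix Astr (1 * (1 / \<gamma> ^ 10) powr (3 / \<gamma> ^ 2)) \<and>
          spectral_norm Apsd \<le> 7 * \<gamma> * N * L \<and>
          max_norm Astr \<le> 2 / \<gamma> ^ 11 * L"
    unfolding Let_def
    by (rule exI[of _ B], rule exI[of _ "A - B"]) (use A B in auto)
qed

end
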